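(* Let $U$ be a finite totally ordered set. There is a bijection between the set of composition matrices on $U$ and the set of ballot matrices in $\mathrm{BalMat}[U]$ fixed under $\eta$. As a result, calling two ballot matrices $A,B\in\mathrm{BalMat}[U]$ equivalent if $P(A)=P(B)$, every equivalence class contains exactly one ballot matrix fixed under $\eta$.
   Context: Ballots. A ballot on a finite set $V$ is a sequence $B_1B_2\cdots B_k$ ($k\ge 0$) of pairwise disjoint non-empty sets (blocks) with union $V$ (its underlying set); the empty ballot is the one with $k=0$, $V=\emptyset$. Ballot matrices. Let $U$ be a finite totally ordered set. A ballot matrix on $U$ is, for some $m\ge 0$, an upper triangular $m\times m$ matrix whose entries $(i,j)$, $1\le i\le j\le m$, are (possibly empty) ballots with pairwise disjoint underlying sets whose union is $U$, such that every row contains at least one non-empty ballot. $\mathrm{BalMat}[U]$ is the set of these. An element $x\in U$ is "on row $i$ and column $j$" if it lies in the underlying set of entry $(i,j)$. A column is empty if all its entries are empty ballots. Composition matrices. A composition matrix on $U$ is an upper triangular $m\times m$ matrix (for some $m\geq 0$) whose entries on and above the diagonal are (possibly empty) pairwise disjoint sets with union $U$, such that no row and no column consists only of empty sets. The poset $P(A)$. For $A\in\mathrm{BalMat}[U]$, $P(A)$ is the poset on $U$ in which, for $x$ in entry $(i,j)$ and $y$ in entry $(i',j')$, $x<y$ if and only if $j<i'$. (It is an interval order.) Ballot involution. For a ballot $B_1\cdots B_k$ on a totally ordered finite set $V$, let $x=\min V$ and $x\in B_i$. If $|B_i|\ge2$, delete $x$ from $B_i$ and insert a new block $\{x\}$ immediately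 to the right of $B_i$. If $B_i=\{x\}$ and $i>1$, delete this block and add $x$ to $B_{i-1}$. If $B_1=\{x\}$, keep $B_1$ and apply the procedure recursively to $B_2\cdots B_k$ on $V\setminus\{x\}$. The empty ballot is fixed. The map $\psi$ on $\mathrm{BalMat}[U]$. Order the entries of a matrix lexicographically by position $(i,j)$, and apply the ballot involution to the first entry not fixed by it; if all entries are fixed, $\psi(A)=A$. Thus $\psi(A)=A$ iff every entry has the form $\{a_1\}\{a_2\}\cdots\{a_r\}$ with $a_1<\dots<a_r$. The map $\varphi$ on the fixed points of $\psi$. Let $\psi(A)=A$. An element $x$ on row $i$ and column $j$ is a pivot of $A$ if either (a) row $i$ contains at least two elements of $U$ and $x$ is the smallest element on row $i$; or (b) column $i$ is empty, $\{x\}$ is the only non-empty ballot on row $i$, and $x$ is smaller than the minimum element of row $i+1$. If $A$ has no pivots, $\varphi(A)=A$. Otherwise let $x$ be the smallest pivot, in entry $(i,j)$. In case (a), remove $x$ from row $i$, make a new row immediately above row $i$ whose only non-empty entry is $\{x\}$ in column $j$, and then insert a new empty column at position $i$, pushing the existing columns $i,i+1,\dots$ (including the one containing $x$) one step to the right. In case (b), remove column $i$ and merge row $i$ into row $i+1$ by inserting the block $\{x\}$ at the front of the ballot in position $(i+1,j)$. The map $\eta$. $\eta(A)=\varphi(A)$ if $\psi(A)=A$, and $\eta(A)=\psi(A)$ if $\psi(A)\ne A$. *)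

theory Defs
  imports "Jordan_Normal_Form.Determinant" "HOL-Library.Disjoint_Sets"
begin

text \<open>
  Matrices are those of \<^theory>\<open>Jordan_Normal_Form.Matrix\<close>, hence rows and columns are numbered
  from 0. The totally ordered set \<open>U\<close> is a finite set of elements of a linearly ordered type.
\<close>

definition underlying :: "'a set list \<Rightarrow> 'a set" where
  "underlying Bs = \<Union> (set Bs)"

definition ballot :: "'a set \<Rightarrow> 'a set list \<Rightarrow> bool" where
  "ballot V Bs \<longleftrightarrow> distinct Bs \<and> partition_on V (set Bs)"

text \<open>The index of the (first) block containing \<open>x\<close>.\<close>

definition block_index :: "'a set list \<Rightarrow> 'a \<Rightarrow> nat" where
  "block_index Bs x = (LEAST i. i < length Bs \<and> x \<in> Bs ! i)"

fun ballot_involution :: "'a::linorder set list \<Rightarrow> 'a set list" where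
  "ballot_involution [] = []"
| "ballot_involution (B # Bs) =
     (let x = Min (underlying (B # Bs));
          i = block_index (B # Bs) x;
          Bi = (B # Bs) ! i
      in if Bi \<noteq> {x} then take i (B # Bs) @ [Bi - {x}, {x}] @ drop (Suc i) (B # Bs)
         else if i > 0 then
           take (i - 1) (B # Bs) @ [insert x ((B # Bs) ! (i - 1))] @ drop (Suc i) (B # Bs)
         else B # ballot_involution Bs)"

definition upper_positions :: "nat \<Rightarrow> (nat \<times> nat) set" where
  "upper_positions m = {(i, j). i \<le> j \<and> j < m}"

text \<open>
  The constant \<open>upper_triangular\<close> of the matrix library requires a zero on the entry type. Here the
  entries below the diagonal are the empty ballot or the empty set, respectively, which makes
  equality of matrices depend only on the entries on and above the diagonal.
\<close>

definition BalMat :: "'a set \<Rightarrow> 'a set list mat set" where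
  "BalMat U = {A. \<exists>m. A \<in> carrier_mat m m
     \<and> (\<forall>i<m. \<forall>j<i. A $$ (i, j) = [])
     \<and> (\<forall>p \<in> upper_positions m. ballot (underlying (A $$ p)) (A $$ p))
     \<and> disjoint_family_on (\<lambda>p. underlying (A $$ p)) (upper_positions m)
     \<and> (\<Union>p \<in> upper_positions m. underlying (A $$ p)) = U
     \<and> (\<forall>i<m. \<exists>j<m. A $$ (i, j) \<noteq> [])}"

definition composition_matrices :: "'a set \<Rightarrow> 'a set mat set" where
  "composition_matrices U = {A. \<exists>m. A \<in> carrier_mat m m
     \<and> (\<forall>i<m. \<forall>j<i. A $$ (i, j) = {})
     \<and> disjoint_family_on (\<lambda>p. A $$ p) (upper_positions m)
     \<and> (\<Union>p \<in> upper_positions m. A $$ p) = U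
     \<and> (\<forall>i<m. \<exists>j<m. A $$ (i, j) \<noteq> {})
     \<and> (\<forall>j<m. \<exists>i<m. A $$ (i, j) \<noteq> {})}"

definition at_entry :: "'a set list mat \<Rightarrow> 'a \<Rightarrow> nat \<Rightarrow> nat \<Rightarrow> bool" where
  "at_entry A x i j \<longleftrightarrow> i < dim_row A \<and> j < dim_col A \<and> x \<in> underlying (A $$ (i, j))"

text \<open>
  The strict order relation of the poset \<open>P(A)\<close>. All matrices that are compared have the same ground
  set \<open>U\<close>, so equality of posets is equality of these relations.
\<close>

definition poset_of :: "'a set list mat \<Rightarrow> 'a rel" where
  "poset_of A = {(x, y). \<exists>i j i' j'. at_entry A x i j \<and> at_entry A y i' j' \<and> j < i'}"

definition equivalent_on :: "'a set \<Rightarrow> 'a set list mat rel" where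
  "equivalent_on U = {(A, B). A \<in> BalMat U \<and> B \<in> BalMat U \<and> poset_of A = poset_of B}"

text \<open>The list comprehension enumerates the positions in lexicographic order.\<close>

definition psi :: "'a::linorder set list mat \<Rightarrow> 'a set list mat" where
  "psi A = (case List.find (\<lambda>p. ballot_involution (A $$ p) \<noteq> A $$ p)
                   [(i, j). i \<leftarrow> [0..<dim_row A], j \<leftarrow> [i..<dim_col A]] of
              None \<Rightarrow> A
            | Some p \<Rightarrow> update_mat A p (ballot_involution (A $$ p)))"

definition row_elements :: "'a set list mat \<Rightarrow> nat \<Rightarrow> 'a set" where
  "row_elements A i = {x. \<exists>j. at_entry A x i j}"

definition column_empty :: "'a set list mat \<Rightarrow> nat \<Rightarrow> bool" where
  "column_empty A j \<longleftrightarrow> (\<forall>i < dim_row A. A $$ (i, j) = [])"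

definition pivot_a :: "'a::linorder set list mat \<Rightarrow> 'a \<Rightarrow> nat \<Rightarrow> nat \<Rightarrow> bool" where
  "pivot_a A x i j \<longleftrightarrow> at_entry A x i j
     \<and> card (row_elements A i) \<ge> 2 \<and> x = Min (row_elements A i)"

text \<open>
  In a ballot matrix the element \<open>x\<close> on row \<open>i\<close> cannot lie in an empty column \<open>i\<close>, so it lies strictly
  to the right of the diagonal and row \<open>i + 1\<close> exists.
\<close>

definition pivot_b :: "'a::linorder set list mat \<Rightarrow> 'a \<Rightarrow> nat \<Rightarrow> nat \<Rightarrow> bool" where
  "pivot_b A x i j \<longleftrightarrow> at_entry A x i j
     \<and> column_empty A i
     \<and> A $$ (i, j) = [{x}] \<and> (\<forall>j' < dim_col A. j' \<noteq> j \<longrightarrow> A $$ (i, j') = [])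
     \<and> x < Min (row_elements A (i + 1))"

definition pivots :: "'a::linorder set list mat \<Rightarrow> 'a set" where
  "pivots A = {x. \<exists>i j. pivot_a A x i j \<or> pivot_b A x i j}"

definition insert_row :: "'b mat \<Rightarrow> nat \<Rightarrow> (nat \<Rightarrow> 'b) \<Rightarrow> 'b mat" where
  "insert_row A i r = mat (dim_row A + 1) (dim_col A)
     (\<lambda>(k, l). if k < i then A $$ (k, l) else if k = i then r l else A $$ (k - 1, l))"

definition insert_column :: "'b mat \<Rightarrow> nat \<Rightarrow> (nat \<Rightarrow> 'b) \<Rightarrow> 'b mat" where
  "insert_column A j c = mat (dim_row A) (dim_col A + 1)
     (\<lambda>(k, l). if l < j then A $$ (k, l) else if l = j then c k else A $$ (k, l - 1))"

text \<open>
  In the fixed points of \<open>psi\<close> all blocks are singletons, so removing the element \<open>x\<close> from a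
  ballot means removing the block \<open>{x}\<close>.
\<close>

definition phi_a :: "'a set list mat \<Rightarrow> 'a \<Rightarrow> nat \<Rightarrow> nat \<Rightarrow> 'a set list mat" where
  "phi_a A x i j =
     (let A1 = update_mat A (i, j) (removeAll {x} (A $$ (i, j)));
          A2 = insert_row A1 i (\<lambda>l. if l = j then [{x}] else [])
      in insert_column A2 i (\<lambda>k. []))"

text \<open>
  Row \<open>i\<close> contains nothing but \<open>x\<close>; merging it into row \<open>i + 1\<close> amounts to inserting the block \<open>{x}\<close>
  there and deleting row \<open>i\<close>. Row \<open>i\<close> and column \<open>i\<close> are deleted together.
\<close>

definition phi_b :: "'a set list mat \<Rightarrow> 'a \<Rightarrow> nat \<Rightarrow> nat \<Rightarrow> 'a set list mat" where
  "phi_b A x i j =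
     mat_delete (update_mat A (i + 1, j) ({x} # A $$ (i + 1, j))) i i"

definition phi :: "'a::linorder set list mat \<Rightarrow> 'a set list mat" where
  "phi A =
     (if pivots A = {} then A
      else let x = Min (pivots A);
               (i, j) = (THE (i, j). at_entry A x i j)
           in if pivot_a A x i j then phi_a A x i j else phi_b A x i j)"

definition eta :: "'a::linorder set list mat \<Rightarrow> 'a set list mat" where
  "eta A = (if psi A = A then phi A else psi A)"

end

theory Submission
  imports Defs
begin

text \<open>
  A matrix on \<open>U\<close> is recorded by the row \<open>r x\<close> and the column \<open>c x\<close> of each element, and its poset
  is \<open>x < y \<longleftrightarrow> c x < r y\<close>. Both kinds of matrices are normal forms for the poset. In a composition
  matrix, the rows are ordered by inclusion of the sets \<open>D x\<close> of predecessors. A matrix fixed by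
  \<open>\<eta>\<close> has exactly one element on each row, and these elements are ordered by inclusion of \<open>D x\<close>,
  ties being broken by decreasing order in \<open>U\<close>. In either case the order of the rows determines
  \<open>r\<close>, and then \<open>c x\<close> is the last row which is not above \<open>x\<close>. Hence both sets are in bijection with
  the set of posets of ballot matrices.
\<close>

subsection \<open>Row and column functions\<close>

text \<open>Surjectivity of \<open>r\<close> onto the row indices says that no row is empty, and
  \<open>r x \<le> c x\<close> that the matrix is upper triangular. Columns may be missed by
  \<open>c\<close>, as in ballot matrices.\<close>

definition places :: "'a set \<Rightarrow> nat \<Rightarrow> ('a \<Rightarrow> nat) \<Rightarrow> ('a \<Rightarrow> nat) \<Rightarrow> bool" where
  "places U m r c \<longleftrightarrow> r ` U = {..<m} \<and> (\<forall>x\<in>U. r x \<le> c x \<and> c x < m)"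

definition interval_rel :: "'a set \<Rightarrow> ('a \<Rightarrow> nat) \<Rightarrow> ('a \<Rightarrow> nat) \<Rightarrow> 'a rel" where
  "interval_rel U r c = {(x, y). x \<in> U \<and> y \<in> U \<and> c x < r y}"

definition predecessors :: "'a rel \<Rightarrow> 'a \<Rightarrow> 'a set" where
  "predecessors P x = {y. (y, x) \<in> P}"

text \<open>The tie-break runs against the order of \<open>U\<close> because a pivot of kind (b)
  arises when the element on the next row is the larger one.\<close>

definition tie_broken_le :: "'a::linorder rel \<Rightarrow> 'a \<Rightarrow> 'a \<Rightarrow> bool" where
  "tie_broken_le P x y \<longleftrightarrow>
     predecessors P x \<subset> predecessors P y \<or> predecessors P x = predecessors P y \<and> y \<le> x"

lemma placesD:
  assumes "places U m r c"
  shows "r ` U = {..<m}" "x \<in> U \<Longrightarrow> r x \<le> c x" "x \<in> U \<Longrightarrow> c x < m" "x \<in> U \<Longrightarrow> r x < m"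
proof -
  show "r ` U = {..<m}" "x \<in> U \<Longrightarrow> r x \<le> c x" and c: "x \<in> U \<Longrightarrow> c x < m"
    using assms by (simp_all add: places_def)
  then show "x \<in> U \<Longrightarrow> r x < m" by (meson le_less_trans)
qed

lemma places_row:
  assumes "places U m r c" "i < m"
  obtains x where "x \<in> U" "r x = i"
proof -
  have "i \<in> r ` U" using assms by (simp add: places_def)
  then show ?thesis using that by auto
qed

lemma predecessors_mono:
  assumes "x \<in> U" "y \<in> U" "r x \<le> r y"
  shows "predecessors (interval_rel U r c) x \<subseteq> predecessors (interval_rel U r c) y"
  using assms by (auto simp: predecessors_def interval_rel_def)

text \<open>One inclusion is monotonicity. The other fails exactly when some \<open>z\<close> has
  its column in \<open>{r x..<r y}\<close>, since such a \<open>z\<close> precedes \<open>y\<close>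
  but not \<open>x\<close>.\<close>

lemma predecessors_eq_iff:
  assumes "x \<in> U" "y \<in> U" "r x \<le> r y"
  shows "predecessors (interval_rel U r c) x = predecessors (interval_rel U r c) y
    \<longleftrightarrow> {r x..<r y} \<inter> c ` U = {}"
proof -
  have "predecessors (interval_rel U r c) y \<subseteq> predecessors (interval_rel U r c) x
    \<longleftrightarrow> (\<forall>z\<in>U. c z < r y \<longrightarrow> c z < r x)"
    using assms by (auto simp: predecessors_def interval_rel_def)
  also have "\<dots> \<longleftrightarrow> {r x..<r y} \<inter> c ` U = {}"
    by (fastforce simp: not_less)
  finally show ?thesis using predecessors_mono[OF assms, of c] by blast
qed

section \<open>Reconstructing rows and columns from a poset and an order of the rows\<close>

text \<open>As the values of \<open>r\<close> form an initial segment, \<open>r x\<close> is the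
  number of distinct values below it. This number depends only on the preorder that \<open>r\<close>
  induces.\<close>

lemma rank_unique:
  fixes r r' :: "'a \<Rightarrow> nat"
  assumes "r ` U = {..<m}" "r' ` U = {..<m'}"
    and le: "\<And>x y. x \<in> U \<Longrightarrow> y \<in> U \<Longrightarrow> r x \<le> r y \<longleftrightarrow> r' x \<le> r' y"
    and "x \<in> U"
  shows "r x = r' x"
proof -
  have rank: "s x = card (s ` {y \<in> U. s y < s x})" if "s ` U = {..<k}" for s :: "'a \<Rightarrow> nat" and k
  proof -
    have "s x < k" using that \<open>x \<in> U\<close> by auto
    have "n \<in> s ` {y \<in> U. s y < s x}" if "n < s x" for n
    proof -
      have "n \<in> s ` U" using that \<open>s x < k\<close> \<open>s ` U = {..<k}\<close> by simp
      then show ?thesis using that by auto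
    qed
    then have "s ` {y \<in> U. s y < s x} = {..<s x}" by auto
    then show ?thesis by simp
  qed
  let ?S = "{y \<in> U. r y < r x}"
  have S: "{y \<in> U. r' y < r' x} = ?S" using le \<open>x \<in> U\<close> by (auto simp flip: not_le)
  have eq: "r y = r z \<longleftrightarrow> r' y = r' z" if "y \<in> U" "z \<in> U" for y z
    using le[OF that] le[OF that(2,1)] by (metis order_antisym order_refl)
  \<comment> \<open>\<open>g\<close> translates values of \<open>r\<close> into values of
    \<open>r'\<close>. It is well defined and injective because both functions have the same
    ties.\<close>
  define g where "g = (\<lambda>n. r' (SOME y. y \<in> ?S \<and> r y = n))"
  have g: "g (r y) = r' y" if "y \<in> ?S" for y
  proof -
    have "\<exists>z. z \<in> ?S \<and> r z = r y" using that by blast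
    from someI_ex[OF this] show ?thesis using that eq unfolding g_def by blast
  qed
  have inj: "inj_on g (r ` ?S)"
  proof (rule inj_onI)
    fix a b assume "a \<in> r ` ?S" "b \<in> r ` ?S" "g a = g b"
    then obtain y z where yz: "y \<in> ?S" "z \<in> ?S" "a = r y" "b = r z" by blast
    with \<open>g a = g b\<close> g have "r' y = r' z" by metis
    with yz eq show "a = b" by blast
  qed
  have "g ` r ` ?S = r' ` ?S" unfolding image_image using g by (rule image_cong[OF refl])
  then have "card (r ` ?S) = card (r' ` ?S)" using card_image[OF inj] by simp
  then show ?thesis using rank[OF assms(1)] rank[OF assms(2)] S by simp
qed

lemma places_unique:
  assumes p: "places U m r c" and p': "places U m' r' c'"
    and le: "\<forall>x\<in>U. \<forall>y\<in>U. r x \<le> r y \<longleftrightarrow> r' x \<le> r' y"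
    and P: "interval_rel U r c = interval_rel U r' c'"
  shows "m = m'" "x \<in> U \<Longrightarrow> r x = r' x" "x \<in> U \<Longrightarrow> c x = c' x"
proof -
  have r: "r x = r' x" if "x \<in> U" for x
    using placesD(1)[OF p] placesD(1)[OF p'] _ that by (rule rank_unique) (use le in blast)
  then have "r ` U = r' ` U" by auto
  then show m: "m = m'" using placesD(1)[OF p] placesD(1)[OF p'] by simp
  show "x \<in> U \<Longrightarrow> r x = r' x" by (rule r)
  assume x: "x \<in> U"
  have iff: "c x < r y \<longleftrightarrow> c' x < r y" if "y \<in> U" for y
  proof -
    have "(x, y) \<in> interval_rel U r c \<longleftrightarrow> (x, y) \<in> interval_rel U r' c'" using P by simp
    then show ?thesis using x that r by (simp add: interval_rel_def)
  qed
  \<comment> \<open>Rows \<open>c x\<close> and \<open>c' x\<close> are both inhabited. Testing the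
    common relation against an element of each gives the two inequalities.\<close>
  have lt: "c x < m" "c' x < m" using placesD(3)[OF p x] placesD(3)[OF p' x] m by auto
  obtain y where "y \<in> U" "r y = c x" using places_row[OF p lt(1)] .
  then have "c x \<le> c' x" using iff[of y] by simp
  moreover obtain z where "z \<in> U" "r z = c' x" using places_row[OF p lt(2)] .
  then have "c' x \<le> c x" using iff[of z] by simp
  ultimately show "c x = c' x" by simp
qed

lemma ex_rank:
  fixes le :: "'a \<Rightarrow> 'a \<Rightarrow> bool"
  assumes "finite U"
    and total: "\<And>x y. x \<in> U \<Longrightarrow> y \<in> U \<Longrightarrow> le x y \<or> le y x"
    and trans: "\<And>x y z. x \<in> U \<Longrightarrow> y \<in> U \<Longrightarrow> z \<in> U \<Longrightarrow> le x y \<Longrightarrow> le y z \<Longrightarrow> le x z"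
  shows "\<exists>m r. r ` U = {..<m::nat} \<and> (\<forall>x\<in>U. \<forall>y\<in>U. r x \<le> r y \<longleftrightarrow> le x y)"
proof -
  \<comment> \<open>The number of elements strictly below \<open>x\<close>. It has the right order
    but skips values when there are ties.\<close>
  define s where "s x = card {y \<in> U. \<not> le x y}" for x
  have s1: "s x \<le> s y" if "x \<in> U" "y \<in> U" "le x y" for x y
  proof -
    have "{z \<in> U. \<not> le x z} \<subseteq> {z \<in> U. \<not> le y z}" using trans[OF that(1,2) _ that(3)] by blast
    then show ?thesis unfolding s_def using assms(1) by (intro card_mono) auto
  qed
  have s2: "s y < s x" if "x \<in> U" "y \<in> U" "\<not> le x y" for x y
  proof -
    have yx: "le y x" "le y y" using total[OF that(1,2)] total[OF that(2,2)] that(3) by auto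
    then have "y \<in> {z \<in> U. \<not> le x z}" "y \<notin> {z \<in> U. \<not> le y z}" using that by auto
    moreover have "{z \<in> U. \<not> le y z} \<subseteq> {z \<in> U. \<not> le x z}"
      using trans[OF that(2,1) _ yx(1)] by blast
    ultimately show ?thesis unfolding s_def using assms(1) by (intro psubset_card_mono) auto
  qed
  have s: "s x \<le> s y \<longleftrightarrow> le x y" if "x \<in> U" "y \<in> U" for x y
    using s1 s2 that by (meson not_le)
  \<comment> \<open>The inverse of the increasing enumeration \<open>h\<close> of the values of
    \<open>s\<close> closes the gaps.\<close>
  obtain h where h: "bij_betw h {..<card (s ` U)} (s ` U)" "strict_mono_on {..<card (s ` U)} h"
    using ex_bij_betw_strict_mono_card[of "s ` U"] assms(1) by blast
  define r where "r = (\<lambda>x. inv_into {..<card (s ` U)} h (s x))"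
  have b: "bij_betw (inv_into {..<card (s ` U)} h) (s ` U) {..<card (s ` U)}"
    by (rule bij_betw_inv_into[OF h(1)])
  then have img: "r ` U = {..<card (s ` U)}"
    unfolding r_def by (simp add: bij_betw_def image_image)
  have hr: "h (r x) = s x" if "x \<in> U" for x
    unfolding r_def using bij_betw_inv_into_right[OF h(1)] that by simp
  have "r x \<le> r y \<longleftrightarrow> le x y" if "x \<in> U" "y \<in> U" for x y
  proof -
    have "r x \<in> {..<card (s ` U)}" "r y \<in> {..<card (s ` U)}" using img that by auto
    then have "r x \<le> r y \<longleftrightarrow> h (r x) \<le> h (r y)" by (simp add: strict_mono_on_less_eq[OF h(2)])
    then show ?thesis using hr s that by simp
  qed
  with img show ?thesis by blast
qed

text \<open>Any total preorder along which the predecessor sets grow can serve as the order of the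
  rows; the columns are then forced by \<open>P\<close>.\<close>

lemma ex_places:
  fixes le :: "'a \<Rightarrow> 'a \<Rightarrow> bool"
  assumes "finite U" and P: "P \<subseteq> U \<times> U" "irrefl P"
    and total: "\<And>x y. x \<in> U \<Longrightarrow> y \<in> U \<Longrightarrow> le x y \<or> le y x"
    and trans: "\<And>x y z. x \<in> U \<Longrightarrow> y \<in> U \<Longrightarrow> z \<in> U \<Longrightarrow> le x y \<Longrightarrow> le y z \<Longrightarrow> le x z"
    and mono: "\<And>x y. x \<in> U \<Longrightarrow> y \<in> U \<Longrightarrow> le x y \<Longrightarrow> predecessors P x \<subseteq> predecessors P y"
  obtains m r c where "places U m r c" "interval_rel U r c = P"
    "\<And>x y. x \<in> U \<Longrightarrow> y \<in> U \<Longrightarrow> r x \<le> r y \<longleftrightarrow> le x y"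
proof -
  have "\<exists>m r. r ` U = {..<m::nat} \<and> (\<forall>x\<in>U. \<forall>y\<in>U. r x \<le> r y \<longleftrightarrow> le x y)"
    by (rule ex_rank[OF assms(1)]; fact total trans)
  then obtain m r where r: "r ` U = {..<m::nat}" "\<And>x y. x \<in> U \<Longrightarrow> y \<in> U \<Longrightarrow> r x \<le> r y \<longleftrightarrow> le x y"
    by blast
  \<comment> \<open>The last row holding an element that is not above \<open>x\<close>. By
    irreflexivity \<open>x\<close> itself is a candidate, so the maximum exists and is at least
    \<open>r x\<close>.\<close>
  define c where "c x = Max (r ` {y \<in> U. (x, y) \<notin> P})" for x
  have fin: "finite (r ` {y \<in> U. (x, y) \<notin> P})" for x using assms(1) by simp
  have rc: "r x \<le> c x" if "x \<in> U" for x
    unfolding c_def using fin P(2) that by (intro Max_ge) (auto simp: irrefl_def)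
  have c_in: "\<exists>z. z \<in> U \<and> (x, z) \<notin> P \<and> c x = r z" if "x \<in> U" for x
  proof -
    have "c x \<in> r ` {y \<in> U. (x, y) \<notin> P}"
      unfolding c_def using fin P(2) that by (intro Max_in) (auto simp: irrefl_def)
    then show ?thesis by auto
  qed
  have "places U m r c"
    unfolding places_def using r(1) rc c_in by fastforce
  moreover have "c x < r y \<longleftrightarrow> (x, y) \<in> P" if "x \<in> U" "y \<in> U" for x y
  proof
    assume "c x < r y"
    show "(x, y) \<in> P"
    proof (rule ccontr)
      assume "(x, y) \<notin> P"
      then have "r y \<le> c x" unfolding c_def using fin that by (intro Max_ge) auto
      with \<open>c x < r y\<close> show False by simp
    qed
  next
    assume xy: "(x, y) \<in> P"
    obtain z where z: "z \<in> U" "(x, z) \<notin> P" "c x = r z" using c_in[OF \<open>x \<in> U\<close>] by blast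
    \<comment> \<open>Otherwise \<open>x\<close>, a predecessor of \<open>y\<close>, would also be
      one of \<open>z\<close>.\<close>
    then have "\<not> le y z" using mono[of y z] that xy by (auto simp: predecessors_def)
    then show "c x < r y" using r(2)[of y z] z that by simp
  qed
  then have "interval_rel U r c = P" using P(1) by (auto simp: interval_rel_def)
  ultimately show ?thesis using that r(2) by blast
qed

text \<open>The nesting of predecessor sets is the characteristic property of interval orders. It
  makes both row orders used below total.\<close>

lemma interval_rel_props:
  assumes "places U m r c"
  shows "interval_rel U r c \<subseteq> U \<times> U" "irrefl (interval_rel U r c)"
    "\<And>x y. x \<in> U \<Longrightarrow> y \<in> U \<Longrightarrow>
      predecessors (interval_rel U r c) x \<subseteq> predecessors (interval_rel U r c) y
      \<or> predecessors (interval_rel U r c) y \<subseteq> predecessors (interval_rel U r c) x"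
  subgoal by (auto simp: interval_rel_def)
  subgoal using placesD(2)[OF assms] by (auto simp: interval_rel_def irrefl_def leD)
  subgoal for x y using predecessors_mono[of x U y r c] predecessors_mono[of y U x r c] by linarith
  done

section \<open>The row order of composition matrices\<close>

text \<open>If \<open>r y < r x\<close>, then column \<open>r y\<close> contains some element, as no
  column is empty. This element precedes \<open>x\<close> but not \<open>y\<close>, so the
  predecessor sets differ.\<close>

lemma row_le_iff_composition:
  assumes p: "places U m r c" and cU: "c ` U = {..<m}" and xy: "x \<in> U" "y \<in> U"
  shows "r x \<le> r y \<longleftrightarrow>
    predecessors (interval_rel U r c) x \<subseteq> predecessors (interval_rel U r c) y"
proof (cases "r x \<le> r y")
  case True
  then show ?thesis using predecessors_mono xy by metis
next
  case False
  then have "r y \<in> {r y..<r x} \<inter> c ` U" using placesD(4)[OF p] xy cU by auto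
  then have "{r y..<r x} \<inter> c ` U \<noteq> {}" by blast
  then have "predecessors (interval_rel U r c) y \<noteq> predecessors (interval_rel U r c) x"
    using predecessors_eq_iff[of y U x r c] xy False by auto
  then show ?thesis using False predecessors_mono[of y U x r c] xy by auto
qed

text \<open>Converse direction: rows \<open>j\<close> and \<open>Suc j\<close> have different
  predecessor sets, and only an element of column \<open>j\<close> can separate them.\<close>

lemma columns_composition:
  assumes p: "places U m r c"
    and le: "\<And>x y. x \<in> U \<Longrightarrow> y \<in> U \<Longrightarrow> r x \<le> r y \<longleftrightarrow>
      predecessors (interval_rel U r c) x \<subseteq> predecessors (interval_rel U r c) y"
  shows "c ` U = {..<m}"
proof (intro equalityI subsetI)
  fix j assume "j \<in> c ` U"
  then show "j \<in> {..<m}" using placesD(3)[OF p] by auto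
next
  fix j assume "j \<in> {..<m}"
  then have j: "j < m" by simp
  obtain x where x: "x \<in> U" "r x = j" using places_row[OF p j] .
  show "j \<in> c ` U"
  proof (cases "Suc j < m")
    case True
    then obtain y where y: "y \<in> U" "r y = Suc j" using places_row[OF p] by blast
    then have "{r x..<r y} \<inter> c ` U \<noteq> {}"
      using predecessors_eq_iff[of x U y r c] le[of y x] x y by auto
    then show ?thesis using x y by auto
  next
    case False
    \<comment> \<open>No next row is available for the last column, but an element of the last row
      must lie on the diagonal.\<close>
    then have "c x = j" using placesD(2,3)[OF p x(1)] x by simp
    then show ?thesis using x by auto
  qed
qed

section \<open>The row order of matrices fixed by \<open>eta\<close>\<close>

text \<open>For matrices with one element on each row this is the absence of pivots of kind
  (b).\<close>

definition no_pivot_b :: "'a::linorder set \<Rightarrow> ('a \<Rightarrow> nat) \<Rightarrow> ('a \<Rightarrow> nat) \<Rightarrow> bool" where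
  "no_pivot_b U r c \<longleftrightarrow> (\<forall>x\<in>U. \<forall>y\<in>U. r y = Suc (r x) \<longrightarrow> r x \<notin> c ` U \<longrightarrow> y < x)"

text \<open>Every column from \<open>r x\<close> up to \<open>r y - 1\<close> is empty, so the
  elements met on the way from row \<open>r x\<close> to row \<open>r y\<close> descend at each
  step.\<close>

lemma no_pivot_b_descending:
  assumes p: "places U m r c" and np: "no_pivot_b U r c"
    and "x \<in> U" "y \<in> U" "r x < r y" "{r x..<r y} \<inter> c ` U = {}"
  shows "y < x"
proof -
  \<comment> \<open>\<open>Q\<close> quantifies over all elements of the two rows so that steps can
    be composed. The guard \<open>k < m\<close> ensures that the intermediate row is
    inhabited.\<close>
  define Q where "Q i k \<longleftrightarrow> k < m \<longrightarrow> {i..<k} \<inter> c ` U = {} \<longrightarrow>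
    (\<forall>x\<in>U. \<forall>y\<in>U. r x = i \<longrightarrow> r y = k \<longrightarrow> y < x)" for i k
  have "Q (r x) (r y)" using \<open>r x < r y\<close>
  proof (induction rule: less_Suc_induct)
    case (1 i)
    then show ?case using np by (auto simp: Q_def no_pivot_b_def)
  next
    case (2 i j k)
    show ?case unfolding Q_def
    proof (intro impI ballI)
      fix u v
      assume k: "k < m" and e: "{i..<k} \<inter> c ` U = {}"
        and uv: "u \<in> U" "v \<in> U" "r u = i" "r v = k"
      have "j < m" using 2 k by simp
      then obtain w where w: "w \<in> U" "r w = j" using places_row[OF p] by blast
      have "{i..<j} \<subseteq> {i..<k}" "{j..<k} \<subseteq> {i..<k}" using 2(1,2) by auto
      then have "{i..<j} \<inter> c ` U = {}" "{j..<k} \<inter> c ` U = {}" using e by blast+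
      then have "w < u" "v < w" using 2(3,4) k \<open>j < m\<close> uv w unfolding Q_def by blast+
      then show "v < u" by simp
    qed
  qed
  then show ?thesis using assms placesD(4)[OF p] by (auto simp: Q_def)
qed

text \<open>Distinct rows with equal predecessor sets have only empty columns between them, so their
  elements descend, in agreement with the tie-break.\<close>

lemma row_le_iff_tie_broken:
  assumes p: "places U m r c" and np: "no_pivot_b U r c" and inj: "inj_on r U"
    and xy: "x \<in> U" "y \<in> U"
  shows "r x \<le> r y \<longleftrightarrow> tie_broken_le (interval_rel U r c) x y"
proof -
  let ?D = "predecessors (interval_rel U r c)"
  consider "r x < r y" | "r x = r y" | "r y < r x" by linarith
  then show ?thesis
  proof cases
    case 1
    then have "?D x \<subseteq> ?D y" "?D x = ?D y \<Longrightarrow> y < x"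
      using predecessors_mono[of x U y r c] predecessors_eq_iff[of x U y r c]
        no_pivot_b_descending[OF p np xy] xy by auto
    then show ?thesis using 1 by (auto simp: tie_broken_le_def)
  next
    case 2
    then have "x = y" using inj xy by (simp add: inj_on_eq_iff)
    then show ?thesis by (simp add: tie_broken_le_def)
  next
    case 3
    then have "?D y \<subseteq> ?D x" "?D x = ?D y \<Longrightarrow> x < y"
      using predecessors_mono[of y U x r c] predecessors_eq_iff[of y U x r c]
        no_pivot_b_descending[OF p np xy(2,1)] xy by auto
    then show ?thesis using 3 by (auto simp: tie_broken_le_def)
  qed
qed

text \<open>An empty column \<open>r x\<close> gives the next row the same predecessors, so the
  tie-break decides. Injectivity of \<open>r\<close> is antisymmetry of the tie-broken
  order.\<close>

lemma tie_broken_imp_no_pivot_b: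
  assumes p: "places U m r c"
    and le: "\<And>x y. x \<in> U \<Longrightarrow> y \<in> U \<Longrightarrow> r x \<le> r y \<longleftrightarrow> tie_broken_le (interval_rel U r c) x y"
  shows "no_pivot_b U r c" "inj_on r U"
proof -
  show "no_pivot_b U r c" unfolding no_pivot_b_def
  proof (intro ballI impI)
    fix x y assume xy: "x \<in> U" "y \<in> U" "r y = Suc (r x)" "r x \<notin> c ` U"
    then have "predecessors (interval_rel U r c) x = predecessors (interval_rel U r c) y"
      by (subst predecessors_eq_iff) auto
    then show "y < x" using le[of y x] xy by (auto simp: tie_broken_le_def)
  qed
  show "inj_on r U"
  proof (rule inj_onI)
    fix x y assume "x \<in> U" "y \<in> U" "r x = r y"
    then show "x = y" using le[of x y] le[of y x] by (auto simp: tie_broken_le_def)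
  qed
qed

subsection \<open>Matrices with given row and column functions\<close>

definition placed :: "'a set \<Rightarrow> nat \<Rightarrow> ('a \<Rightarrow> nat) \<Rightarrow> ('a \<Rightarrow> nat) \<Rightarrow> 'a set mat" where
  "placed U m r c = mat m m (\<lambda>(i, j). {x \<in> U. r x = i \<and> c x = j})"

text \<open>This embeds composition matrices into ballot matrices with the same poset. In the
  matrices fixed by \<open>eta\<close> it is applied to sets with at most one element.\<close>

definition single_block :: "'a set \<Rightarrow> 'a set list" where
  "single_block V = (if V = {} then [] else [V])"

lemma inj_on_fiber: "inj_on r U \<Longrightarrow> y \<in> U \<Longrightarrow> {x \<in> U. r x = r y} = {y}"
  by (auto dest: inj_onD)

lemma placed_carrier [simp]: "placed U m r c \<in> carrier_mat m m"
  "dim_row (placed U m r c) = m" "dim_col (placed U m r c) = m"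
  by (simp_all add: placed_def)

lemma placed_index [simp]:
  "i < m \<Longrightarrow> j < m \<Longrightarrow> placed U m r c $$ (i, j) = {x \<in> U. r x = i \<and> c x = j}"
  by (simp add: placed_def)

lemma placed_cong:
  "(\<And>x. x \<in> U \<Longrightarrow> r x = r' x) \<Longrightarrow> (\<And>x. x \<in> U \<Longrightarrow> c x = c' x) \<Longrightarrow> placed U m r c = placed U m r' c'"
  unfolding placed_def by (intro cong_mat) auto

lemma underlying_single_block [simp]: "underlying (single_block V) = V"
  by (simp add: single_block_def underlying_def)

lemma underlying_Nil [simp]: "underlying [] = {}"
  by (simp add: underlying_def)

lemma ballot_single_block: "ballot V (single_block V)"
  by (simp add: ballot_def single_block_def partition_on_def)

lemma ballot_underlying_empty: "ballot V Bs \<Longrightarrow> V = {} \<longleftrightarrow> Bs = []"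
  by (cases Bs) (auto simp: ballot_def partition_on_def)

lemma ballot_singleton:
  assumes "ballot {x} Bs"
  shows "Bs = [{x}]"
proof -
  have Bs: "distinct Bs" "\<Union> (set Bs) = {x}" "{} \<notin> set Bs"
    using assms by (auto simp: ballot_def partition_on_def)
  have "B = {x}" if "B \<in> set Bs" for B
  proof -
    have "B \<subseteq> {x}" "B \<noteq> {}" using Bs(2,3) that by auto
    then show ?thesis by blast
  qed
  then have "set Bs \<subseteq> {{x}}" by (simp add: subset_iff)
  moreover have "set Bs \<noteq> {}" using Bs(2) by auto
  ultimately have set: "set Bs = {{x}}" by (simp add: subset_singleton_iff)
  then obtain y where "Bs = [y]" using distinct_card[OF Bs(1)] by (metis One_nat_def card.empty
        card_insert_disjoint empty_iff finite.emptyI length_0_conv length_Suc_conv)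
  then show ?thesis using set by simp
qed

text \<open>By disjointness each element lies in exactly one entry, whose coordinates are
  \<open>r x\<close> and \<open>c x\<close>. The hypotheses are those shared by composition matrices
  and the underlying sets of ballot matrices.\<close>

lemma ex_placed:
  assumes C: "C \<in> carrier_mat m m" "\<forall>i<m. \<forall>j<i. C $$ (i, j) = {}"
    "disjoint_family_on (\<lambda>p. C $$ p) (upper_positions m)"
    "(\<Union>p \<in> upper_positions m. C $$ p) = U"
    "\<forall>i<m. \<exists>j<m. C $$ (i, j) \<noteq> {}"
  shows "\<exists>r c. places U m r c \<and> C = placed U m r c"
proof -
  have "\<exists>p. \<forall>x. x \<in> U \<longrightarrow> p x \<in> upper_positions m \<and> x \<in> C $$ (p x)"
    using C(4) by (intro choice) auto
  then obtain p where p: "\<And>x. x \<in> U \<Longrightarrow> p x \<in> upper_positions m" "\<And>x. x \<in> U \<Longrightarrow> x \<in> C $$ (p x)"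
    by blast
  have uniq: "p x = q" if "q \<in> upper_positions m" "x \<in> C $$ q" for x q
  proof -
    have "x \<in> U" using that C(4) by auto
    then show ?thesis using p[of x] that C(3) unfolding disjoint_family_on_def by blast
  qed
  define r c where "r = fst \<circ> p" and "c = snd \<circ> p"
  have rc: "r x \<le> c x" "c x < m" if "x \<in> U" for x
    using p(1)[OF that] by (auto simp: r_def c_def upper_positions_def)
  have entry: "x \<in> C $$ (i, j) \<longleftrightarrow> x \<in> U \<and> r x = i \<and> c x = j" if "i < m" "j < m" for x i j
  proof
    assume x: "x \<in> C $$ (i, j)"
    then have "i \<le> j" using C(2) that by (metis empty_iff not_le)
    then have q: "(i, j) \<in> upper_positions m" using that by (simp add: upper_positions_def)
    then show "x \<in> U \<and> r x = i \<and> c x = j"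
      using uniq[OF q x] C(4) x by (auto simp: r_def c_def)
  next
    assume "x \<in> U \<and> r x = i \<and> c x = j"
    then show "x \<in> C $$ (i, j)" using p(2)[of x] by (auto simp: r_def c_def)
  qed
  have "C = placed U m r c"
    by (rule eq_matI) (use C(1) entry in auto)
  moreover have "r ` U = {..<m}"
  proof (intro equalityI subsetI)
    fix i assume "i \<in> {..<m}"
    then obtain j x where "j < m" "x \<in> C $$ (i, j)" "i < m" using C(5) by blast
    then show "i \<in> r ` U" using entry by auto
  qed (use rc in force)
  ultimately have "places U m r c \<and> C = placed U m r c" using rc by (simp add: places_def)
  then show ?thesis by blast
qed

lemma placed_props:
  assumes p: "places U m r c"
  shows "\<forall>i<m. \<forall>j<i. placed U m r c $$ (i, j) = {}"
    "disjoint_family_on (\<lambda>p. placed U m r c $$ p) (upper_positions m)"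
    "(\<Union>p \<in> upper_positions m. placed U m r c $$ p) = U"
    "\<forall>i<m. \<exists>j<m. placed U m r c $$ (i, j) \<noteq> {}"
proof -
  have rc: "r x \<le> c x" "c x < m" "r x < m" if "x \<in> U" for x using placesD[OF p] that by auto
  show "\<forall>i<m. \<forall>j<i. placed U m r c $$ (i, j) = {}"
    using rc by (fastforce simp: leD)
  show "disjoint_family_on (\<lambda>p. placed U m r c $$ p) (upper_positions m)"
    by (auto simp: disjoint_family_on_def upper_positions_def)
  show "(\<Union>p \<in> upper_positions m. placed U m r c $$ p) = U"
  proof (intro equalityI subsetI)
    fix x assume "x \<in> U"
    then have "(r x, c x) \<in> upper_positions m" "x \<in> placed U m r c $$ (r x, c x)"
      using rc by (auto simp: upper_positions_def)
    then show "x \<in> (\<Union>p \<in> upper_positions m. placed U m r c $$ p)" by blast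
  qed (auto simp: upper_positions_def)
  show "\<forall>i<m. \<exists>j<m. placed U m r c $$ (i, j) \<noteq> {}"
  proof (intro allI impI)
    fix i assume i: "i < m"
    obtain x where x: "x \<in> U" "r x = i" using places_row[OF p i] .
    then have "placed U m r c $$ (i, c x) \<noteq> {}" using rc i by auto
    then show "\<exists>j<m. placed U m r c $$ (i, j) \<noteq> {}" using rc x by blast
  qed
qed

section \<open>Composition and ballot matrices in terms of rows and columns\<close>

lemma composition_matrices_iff:
  "C \<in> composition_matrices U \<longleftrightarrow>
    (\<exists>m r c. places U m r c \<and> c ` U = {..<m} \<and> C = placed U m r c)"
proof
  assume "C \<in> composition_matrices U"
  then obtain m where C: "C \<in> carrier_mat m m" "\<forall>i<m. \<forall>j<i. C $$ (i, j) = {}"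
    "disjoint_family_on (\<lambda>p. C $$ p) (upper_positions m)"
    "(\<Union>p \<in> upper_positions m. C $$ p) = U"
    "\<forall>i<m. \<exists>j<m. C $$ (i, j) \<noteq> {}" "\<forall>j<m. \<exists>i<m. C $$ (i, j) \<noteq> {}"
    unfolding composition_matrices_def by blast
  obtain r c where rc: "places U m r c" "C = placed U m r c" using ex_placed[OF C(1-5)] by blast
  have "c ` U = {..<m}"
  proof (intro equalityI subsetI)
    fix j assume "j \<in> {..<m}"
    then obtain i x where "i < m" "j < m" "x \<in> C $$ (i, j)" using C(6) by blast
    then show "j \<in> c ` U" using rc by auto
  qed (use placesD[OF rc(1)] in auto)
  then show "\<exists>m r c. places U m r c \<and> c ` U = {..<m} \<and> C = placed U m r c" using rc by blast
next
  assume "\<exists>m r c. places U m r c \<and> c ` U = {..<m} \<and> C = placed U m r c"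
  then obtain m r c where rc: "places U m r c" "c ` U = {..<m}" "C = placed U m r c" by blast
  have "\<exists>i<m. placed U m r c $$ (i, j) \<noteq> {}" if j: "j < m" for j
  proof -
    have "j \<in> c ` U" using j rc(2) by simp
    then obtain x where x: "x \<in> U" "c x = j" by auto
    then have "placed U m r c $$ (r x, j) \<noteq> {}" "r x < m" using placesD(4)[OF rc(1)] j by auto
    then show ?thesis by blast
  qed
  then show "C \<in> composition_matrices U"
    unfolding composition_matrices_def rc(3) using placed_props[OF rc(1)] 
    by (intro CollectI exI[of _ m]) simp
qed

text \<open>A ballot is empty exactly if its underlying set is, so the matrix of underlying sets
  still has no empty row. The functions \<open>r\<close> and \<open>c\<close> forget only the block
  structure, which the poset does not see either.\<close>

lemma BalMat_placed:
  assumes "A \<in> BalMat U"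
  obtains m r c where "places U m r c" "map_mat underlying A = placed U m r c"
    "A \<in> carrier_mat m m"
    "\<forall>i<m. \<forall>j<m. ballot {x \<in> U. r x = i \<and> c x = j} (A $$ (i, j))"
proof -
  obtain m where A: "A \<in> carrier_mat m m" "\<forall>i<m. \<forall>j<i. A $$ (i, j) = []"
    "\<forall>p \<in> upper_positions m. ballot (underlying (A $$ p)) (A $$ p)"
    "disjoint_family_on (\<lambda>p. underlying (A $$ p)) (upper_positions m)"
    "(\<Union>p \<in> upper_positions m. underlying (A $$ p)) = U"
    "\<forall>i<m. \<exists>j<m. A $$ (i, j) \<noteq> []"
    using assms unfolding BalMat_def by blast
  let ?C = "map_mat underlying A"
  have idx: "?C $$ p = underlying (A $$ p)" if "p \<in> upper_positions m" for p
    using that A(1) by (auto simp: upper_positions_def)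
  have bal: "ballot (underlying (A $$ (i, j))) (A $$ (i, j))" if "i < m" "j < m" for i j
  proof (cases "i \<le> j")
    case True
    then show ?thesis using A(3) that by (auto simp: upper_positions_def)
  next
    case False
    then show ?thesis using A(2) that by (simp add: ballot_def partition_on_def)
  qed
  have 1: "?C \<in> carrier_mat m m" using A(1) by simp
  have 2: "\<forall>i<m. \<forall>j<i. ?C $$ (i, j) = {}" using A(1,2) by simp
  have 3: "disjoint_family_on (\<lambda>p. ?C $$ p) (upper_positions m)"
    using A(4) idx unfolding disjoint_family_on_def by simp
  have 4: "(\<Union>p \<in> upper_positions m. ?C $$ p) = U" using A(5) idx by simp
  have 5: "\<forall>i<m. \<exists>j<m. ?C $$ (i, j) \<noteq> {}"
  proof (intro allI impI)
    fix i assume i: "i < m"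
    then obtain j where j: "j < m" "A $$ (i, j) \<noteq> []" using A(6) by blast
    then have "?C $$ (i, j) \<noteq> {}" using ballot_underlying_empty[OF bal[OF i j(1)]] A(1) i by simp
    then show "\<exists>j<m. ?C $$ (i, j) \<noteq> {}" using j(1) by blast
  qed
  obtain r c where rc: "places U m r c" "?C = placed U m r c" using ex_placed[OF 1 2 3 4 5] by blast
  have "underlying (A $$ (i, j)) = {x \<in> U. r x = i \<and> c x = j}" if "i < m" "j < m" for i j
    using arg_cong[OF rc(2), of "\<lambda>C. C $$ (i, j)"] that A(1) by simp
  then have "\<forall>i<m. \<forall>j<m. ballot {x \<in> U. r x = i \<and> c x = j} (A $$ (i, j))"
    using bal by simp
  then show ?thesis by (rule that[OF rc A(1)])
qed

lemma single_block_BalMat: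
  assumes "places U m r c"
  shows "map_mat single_block (placed U m r c) \<in> BalMat U"
proof -
  let ?C = "placed U m r c"
  have idx: "map_mat single_block ?C $$ p = single_block (?C $$ p)" if "p \<in> upper_positions m" for p
    using that by (auto simp: upper_positions_def)
  show ?thesis unfolding BalMat_def
  proof (intro CollectI exI[of _ m] conjI)
    show "map_mat single_block ?C \<in> carrier_mat m m" by simp
    show "\<forall>i<m. \<forall>j<i. map_mat single_block ?C $$ (i, j) = []"
      using placed_props(1)[OF assms] by (simp add: single_block_def)
    show "\<forall>p\<in>upper_positions m. ballot (underlying (map_mat single_block ?C $$ p)) (map_mat single_block ?C $$ p)"
      by (simp add: idx ballot_single_block)
    show "disjoint_family_on (\<lambda>p. underlying (map_mat single_block ?C $$ p)) (upper_positions m)"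
      using placed_props(2)[OF assms] idx by (simp add: disjoint_family_on_def)
    show "(\<Union>p\<in>upper_positions m. underlying (map_mat single_block ?C $$ p)) = U"
      using placed_props(3)[OF assms] idx by simp
    show "\<forall>i<m. \<exists>j<m. map_mat single_block ?C $$ (i, j) \<noteq> []"
      using placed_props(4)[OF assms] by (metis index_map_mat(1) placed_carrier(2,3)
          ballot_underlying_empty ballot_single_block)
  qed
qed

lemma map_underlying_single_block [simp]: "map_mat underlying (map_mat single_block C) = C"
  by (rule eq_matI) auto

lemma at_entry_placed:
  assumes p: "places U m r c" and A: "map_mat underlying A = placed U m r c"
  shows "at_entry A x i j \<longleftrightarrow> x \<in> U \<and> i = r x \<and> j = c x"
proof -
  have d: "dim_row A = m" "dim_col A = m"
    using arg_cong[OF A, of dim_row] arg_cong[OF A, of dim_col] by simp_all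
  have "underlying (A $$ (i, j)) = {x \<in> U. r x = i \<and> c x = j}" if "i < m" "j < m"
    using arg_cong[OF A, of "\<lambda>C. C $$ (i, j)"] that d by simp
  then show ?thesis using placesD[OF p] by (auto simp: at_entry_def d)
qed

lemma poset_of_placed:
  assumes "places U m r c" "map_mat underlying A = placed U m r c"
  shows "poset_of A = interval_rel U r c"
  by (auto simp: poset_of_def interval_rel_def at_entry_placed[OF assms])

subsection \<open>The fixed points\<close>

text \<open>The map \<open>\<phi>\<close> changes the dimension of every matrix that has a pivot.\<close>

lemma phi_fixed_iff: "phi A = A \<longleftrightarrow> pivots A = {}"
proof
  assume fixed: "phi A = A"
  show "pivots A = {}"
  proof (rule ccontr)
    assume ne: "pivots A \<noteq> {}"
    \<comment> \<open>Subtraction on naturals is truncated, so deleting a row lowers the dimension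
      only if there is a row.\<close>
    then have "0 < dim_row A" by (auto simp: pivots_def pivot_a_def pivot_b_def at_entry_def)
    then have "dim_row (phi_b A x i j) \<noteq> dim_row A" for x i j
      by (simp add: phi_b_def mat_delete_def)
    then have b: "phi_b A x i j \<noteq> A" for x i j by metis
    have "dim_col (phi_a A x i j) \<noteq> dim_col A" for x i j
      by (simp add: phi_a_def insert_column_def insert_row_def Let_def)
    then have "phi_a A x i j \<noteq> A" for x i j by metis
    with b have "phi A \<noteq> A" using ne by (simp add: phi_def Let_def split: prod.split)
    with fixed show False by simp
  qed
qed (simp add: phi_def)

lemma eta_fixed_iff: "eta A = A \<longleftrightarrow> psi A = A \<and> pivots A = {}"
  by (auto simp: eta_def phi_fixed_iff)

lemma ballot_involution_singleton: "ballot_involution [{x}] = [{x}]"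
proof -
  have "block_index [{x}] x = 0"
    unfolding block_index_def by (rule Least_equality) auto
  then show ?thesis by (simp add: underlying_def)
qed

lemma row_elements_placed:
  assumes "places U m r c" "map_mat underlying A = placed U m r c"
  shows "row_elements A i = {x \<in> U. r x = i}"
  by (auto simp: row_elements_def at_entry_placed[OF assms])

text \<open>The minimum of a row with two elements would be a pivot of kind (a), so each row has a
  single element and every non-empty entry is forced to be one singleton block. A violation of
  \<open>no_pivot_b\<close> would then be a pivot of kind (b).\<close>

lemma eta_fixed_imp:
  fixes U :: "'a::linorder set"
  assumes "finite U" "A \<in> BalMat U" "eta A = A"
  shows "\<exists>m r c. places U m r c \<and> inj_on r U \<and> no_pivot_b U r c
    \<and> A = map_mat single_block (placed U m r c)"
proof -
  obtain m r c where p: "places U m r c" and A: "map_mat underlying A = placed U m r c"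
    and dim: "A \<in> carrier_mat m m"
    and "\<forall>i<m. \<forall>j<m. ballot {x \<in> U. r x = i \<and> c x = j} (A $$ (i, j))"
    by (rule BalMat_placed[OF assms(2)])
  then have bal: "ballot {x \<in> U. r x = i \<and> c x = j} (A $$ (i, j))" if "i < m" "j < m" for i j
    using that by blast
  have "pivots A = {}" using assms(3) by (simp add: eta_fixed_iff)
  then have no_a: "\<not> pivot_a A x i j" and no_b: "\<not> pivot_b A x i j" for x i j
    by (auto simp: pivots_def)
  note at = at_entry_placed[OF p A] and row = row_elements_placed[OF p A]
  have inj: "inj_on r U"
  proof (rule inj_onI, rule ccontr)
    fix x y assume xy: "x \<in> U" "y \<in> U" "r x = r y" "x \<noteq> y"
    let ?R = "row_elements A (r x)"
    have R: "finite ?R" "{x, y} \<subseteq> ?R" using assms(1) xy by (auto simp: row)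
    have "Min ?R \<in> ?R" using R by (intro Min_in) auto
    moreover have "2 \<le> card ?R" using card_mono[OF R] xy(4) by simp
    ultimately have "pivot_a A (Min ?R) (r x) (c (Min ?R))"
      unfolding pivot_a_def at by (auto simp: row)
    then show False using no_a by blast
  qed
  have blocks: "A $$ (i, j) = single_block {x \<in> U. r x = i \<and> c x = j}" if "i < m" "j < m" for i j
  proof (cases "{x \<in> U. r x = i \<and> c x = j} = {}")
    case True
    then show ?thesis using ballot_underlying_empty[OF bal[OF that]] unfolding single_block_def by metis
  next
    case False
    then obtain x where "{x \<in> U. r x = i \<and> c x = j} = {x}" using inj by (auto dest: inj_onD)
    then show ?thesis using bal[OF that] ballot_singleton by (simp add: single_block_def)
  qed
  have "no_pivot_b U r c" unfolding no_pivot_b_def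
  proof (intro ballI impI, rule ccontr)
    fix x y assume xy: "x \<in> U" "y \<in> U" "r y = Suc (r x)" "r x \<notin> c ` U" "\<not> y < x"
    have "x < y" using xy by (metis n_not_Suc_n linorder_less_linear)
    moreover have "row_elements A (r x + 1) = {y}"
      using inj_on_fiber[OF inj xy(2)] xy(3) by (simp add: row)
    moreover have lt: "r x < m" "c x < m" using placesD[OF p] xy(1) by auto
    moreover have "\<forall>z\<in>U. c z \<noteq> r x" using xy(4) by (metis imageI)
    then have "column_empty A (r x)"
      using dim lt blocks by (auto simp: column_empty_def single_block_def)
    moreover have "A $$ (r x, j) = (if j = c x then [{x}] else [])" if "j < m" for j
    proof -
      have "{z \<in> U. r z = r x \<and> c z = j} = (if j = c x then {x} else {})"
        using inj xy(1) by (auto dest: inj_onD)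
      then show ?thesis by (simp only: blocks[OF lt(1) that]) (simp add: single_block_def)
    qed
    ultimately have "pivot_b A x (r x) (c x)"
      using dim xy(1) by (simp add: pivot_b_def at)
    then show False using no_b by blast
  qed
  moreover have "A = map_mat single_block (placed U m r c)"
    by (rule eq_matI) (use dim blocks in auto)
  ultimately show ?thesis using p inj by blast
qed

text \<open>With one element per row, every entry is empty or a single singleton block, hence fixed
  by the ballot involution, and no pivot of kind (a) exists. A pivot of kind (b) contradicts
  \<open>no_pivot_b\<close>.\<close>

lemma eta_fixed_single_block:
  fixes U :: "'a::linorder set"
  assumes p: "places U m r c" and inj: "inj_on r U" and np: "no_pivot_b U r c"
  shows "eta (map_mat single_block (placed U m r c)) = map_mat single_block (placed U m r c)"
    (is "eta ?A = ?A")
proof -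
  note A = map_underlying_single_block[of "placed U m r c"]
  note at = at_entry_placed[OF p A] and row = row_elements_placed[OF p A]
  have "ballot_involution (?A $$ (i, j)) = ?A $$ (i, j)" if ij: "i < m" "j < m" for i j
  proof (cases "{x \<in> U. r x = i \<and> c x = j} = {}")
    case True
    then show ?thesis using ij by (simp add: single_block_def)
  next
    case False
    then obtain x where "{x \<in> U. r x = i \<and> c x = j} = {x}" using inj by (auto dest: inj_onD)
    then show ?thesis using ij ballot_involution_singleton by (simp add: single_block_def)
  qed
  then have "List.find (\<lambda>p. ballot_involution (?A $$ p) \<noteq> ?A $$ p)
      [(i, j). i \<leftarrow> [0..<dim_row ?A], j \<leftarrow> [i..<dim_col ?A]] = None"
    unfolding find_None_iff by auto
  then have "psi ?A = ?A" by (simp only: psi_def option.case)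
  moreover have "\<not> pivot_a ?A x i j" for x i j
  proof
    assume "pivot_a ?A x i j"
    then have x: "x \<in> U" "r x = i" "2 \<le> card (row_elements ?A i)"
      unfolding pivot_a_def at by blast+
    then have "row_elements ?A i = {x}" using inj by (auto simp: row dest: inj_onD)
    with x show False by simp
  qed
  moreover have "\<not> pivot_b ?A x i j" for x i j
  proof
    assume piv: "pivot_b ?A x i j"
    then have x: "x \<in> U" "r x = i" by (auto simp: pivot_b_def at)
    have "i \<notin> c ` U"
    proof
      assume "i \<in> c ` U"
      then obtain z where z: "z \<in> U" "c z = i" by auto
      then have "at_entry ?A z (r z) i" by (simp add: at)
      then show False using piv by (auto simp: pivot_b_def column_empty_def at_entry_def)
    qed
    \<comment> \<open>As column \<open>i\<close> is empty, \<open>x\<close> lies strictly right of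
      the diagonal. So row \<open>i + 1\<close> exists and the \<open>Min\<close> in
      \<open>pivot_b\<close> is that of a non-empty set.\<close>
    then have "Suc i < m" using placesD(2,3)[OF p x(1)] x
      by (metis image_eqI le_neq_implies_less less_trans_Suc)
    then obtain y where y: "y \<in> U" "r y = Suc i" using places_row[OF p] by blast
    then have "row_elements ?A (i + 1) = {y}" using inj_on_fiber[OF inj y(1)] by (simp add: row)
    then have "x < y" using piv by (simp add: pivot_b_def)
    moreover have "y < x" using np x y \<open>i \<notin> c ` U\<close> unfolding no_pivot_b_def by blast
    ultimately show False by simp
  qed
  ultimately show ?thesis by (simp add: eta_fixed_iff pivots_def)
qed

subsection \<open>Both normal forms are parametrized by the posets\<close>

text \<open>The poset determines the tie-broken order, which is the order of the rows; the rows and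
  the poset then determine the columns.\<close>

lemma inj_on_poset_of_fixed:
  fixes U :: "'a::linorder set"
  assumes "finite U"
  shows "inj_on poset_of {A \<in> BalMat U. eta A = A}"
proof (rule inj_onI)
  fix A B assume "A \<in> {A \<in> BalMat U. eta A = A}" "B \<in> {A \<in> BalMat U. eta A = A}"
    and PAB: "poset_of A = poset_of B"
  then have AB: "A \<in> BalMat U" "eta A = A" "B \<in> BalMat U" "eta B = B" by auto
  obtain m r c where A: "places U m r c" "inj_on r U" "no_pivot_b U r c"
      "A = map_mat single_block (placed U m r c)"
    using eta_fixed_imp[OF assms AB(1,2)] by blast
  obtain m' r' c' where B: "places U m' r' c'" "inj_on r' U" "no_pivot_b U r' c'"
      "B = map_mat single_block (placed U m' r' c')"
    using eta_fixed_imp[OF assms AB(3,4)] by blast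
  have P: "interval_rel U r c = interval_rel U r' c'"
    using PAB poset_of_placed[OF A(1)] poset_of_placed[OF B(1)] by (simp add: A(4) B(4))
  have "\<forall>x\<in>U. \<forall>y\<in>U. r x \<le> r y \<longleftrightarrow> r' x \<le> r' y"
    using row_le_iff_tie_broken[OF A(1,3,2)] row_le_iff_tie_broken[OF B(1,3,2)] P by simp
  note u = places_unique[OF A(1) B(1) this P]
  have "placed U m r c = placed U m' r' c'" unfolding u(1) by (rule placed_cong) (use u in auto)
  then show "A = B" using A(4) B(4) by simp
qed

text \<open>Ranking \<open>U\<close> by the tie-broken order of the poset of \<open>B\<close> gives
  the rows. This order is total because the predecessor sets are nested.\<close>

lemma ex_fixed_poset:
  fixes U :: "'a::linorder set"
  assumes "finite U" "B \<in> BalMat U"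
  shows "\<exists>A \<in> BalMat U. eta A = A \<and> poset_of A = poset_of B"
proof -
  obtain k s d where p: "places U k s d" and B: "map_mat underlying B = placed U k s d"
    using BalMat_placed[OF assms(2)] by metis
  note P = poset_of_placed[OF p B]
  let ?P = "interval_rel U s d"
  note props = interval_rel_props[OF p]
  obtain m r c where rc: "places U m r c" "interval_rel U r c = ?P"
    "\<And>x y. x \<in> U \<Longrightarrow> y \<in> U \<Longrightarrow> r x \<le> r y \<longleftrightarrow> tie_broken_le ?P x y"
  proof (rule ex_places[OF assms(1) props(1,2), of "tie_broken_le ?P"])
    show "tie_broken_le ?P x y \<or> tie_broken_le ?P y x" if "x \<in> U" "y \<in> U" for x y
      using props(3)[OF that] linear[of x y] unfolding tie_broken_le_def psubset_eq by metis
  qed (auto simp: tie_broken_le_def)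
  note np = tie_broken_imp_no_pivot_b[OF rc(1), unfolded rc(2), OF rc(3)]
  have "poset_of (map_mat single_block (placed U m r c)) = ?P"
    using poset_of_placed[OF rc(1) map_underlying_single_block] rc(2) by simp
  then show ?thesis
    using single_block_BalMat[OF rc(1)] eta_fixed_single_block[OF rc(1) np(2,1)] P by metis
qed

lemma inj_on_poset_of_composition:
  "inj_on (\<lambda>C. poset_of (map_mat single_block C)) (composition_matrices U)"
proof (rule inj_onI)
  fix A B assume "A \<in> composition_matrices U" "B \<in> composition_matrices U"
    and PAB: "poset_of (map_mat single_block A) = poset_of (map_mat single_block B)"
  then obtain m r c m' r' c'
    where A: "places U m r c" "c ` U = {..<m}" "A = placed U m r c"
      and B: "places U m' r' c'" "c' ` U = {..<m'}" "B = placed U m' r' c'"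
    unfolding composition_matrices_iff by blast
  have P: "interval_rel U r c = interval_rel U r' c'"
    using PAB poset_of_placed[OF A(1)] poset_of_placed[OF B(1)] by (simp add: A(3) B(3))
  have "\<forall>x\<in>U. \<forall>y\<in>U. r x \<le> r y \<longleftrightarrow> r' x \<le> r' y"
    using row_le_iff_composition[OF A(1,2)] row_le_iff_composition[OF B(1,2)] P by simp
  note u = places_unique[OF A(1) B(1) this P]
  show "A = B" unfolding A(3) B(3) u(1) by (rule placed_cong) (use u in auto)
qed

text \<open>Here the rows come from inclusion of predecessor sets alone, so elements with equal
  predecessor sets share a row.\<close>

lemma ex_composition_poset:
  assumes "finite U" "B \<in> BalMat U"
  shows "\<exists>C \<in> composition_matrices U. poset_of (map_mat single_block C) = poset_of B"
proof -
  obtain k s d where p: "places U k s d" and B: "map_mat underlying B = placed U k s d"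
    using BalMat_placed[OF assms(2)] by metis
  note P = poset_of_placed[OF p B]
  let ?P = "interval_rel U s d"
  note props = interval_rel_props[OF p]
  obtain m r c where rc: "places U m r c" "interval_rel U r c = ?P"
    "\<And>x y. x \<in> U \<Longrightarrow> y \<in> U \<Longrightarrow> r x \<le> r y \<longleftrightarrow> predecessors ?P x \<subseteq> predecessors ?P y"
    by (rule ex_places[OF assms(1) props(1,2), of "\<lambda>x y. predecessors ?P x \<subseteq> predecessors ?P y"])
      (use props(3) in auto)
  have "c ` U = {..<m}" using columns_composition[OF rc(1), unfolded rc(2), OF rc(3)] .
  then have "placed U m r c \<in> composition_matrices U"
    unfolding composition_matrices_iff using rc(1) by blast
  moreover have "poset_of (map_mat single_block (placed U m r c)) = ?P"
    using poset_of_placed[OF rc(1) map_underlying_single_block] rc(2) by simp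
  ultimately show ?thesis using P by metis
qed

theorem proposition3:
  fixes U :: "'a::linorder set"
  assumes "finite U"
  shows "(\<exists>f. bij_betw f (composition_matrices U) {A \<in> BalMat U. eta A = A})
    \<and> (\<forall>C \<in> BalMat U // equivalent_on U. \<exists>!A. A \<in> C \<and> eta A = A)"
proof
  let ?F = "{A \<in> BalMat U. eta A = A}" and ?K = "composition_matrices U"
  let ?g = "\<lambda>C. poset_of (map_mat single_block C)"
  have "bij_betw poset_of ?F (poset_of ` BalMat U)"
    unfolding bij_betw_def
  proof (intro conjI inj_on_poset_of_fixed[OF assms] equalityI subsetI)
    fix P assume "P \<in> poset_of ` BalMat U"
    then obtain B where "B \<in> BalMat U" "P = poset_of B" by blast
    then obtain A where "A \<in> ?F" "P = poset_of A" using ex_fixed_poset[OF assms, of B] by auto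
    then show "P \<in> poset_of ` ?F" by blast
  qed auto
  then have "bij_betw (inv_into ?F poset_of) (poset_of ` BalMat U) ?F" by (rule bij_betw_inv_into)
  moreover have "bij_betw ?g ?K (poset_of ` BalMat U)"
    unfolding bij_betw_def
  proof (intro conjI inj_on_poset_of_composition equalityI subsetI)
    fix P assume "P \<in> ?g ` ?K"
    then obtain C where "C \<in> ?K" "P = ?g C" by blast
    then show "P \<in> poset_of ` BalMat U"
      using single_block_BalMat unfolding composition_matrices_iff by blast
  next
    fix P assume "P \<in> poset_of ` BalMat U"
    then obtain B where "B \<in> BalMat U" "P = poset_of B" by blast
    then obtain C where "C \<in> ?K" "P = ?g C" using ex_composition_poset[OF assms, of B] by auto
    then show "P \<in> ?g ` ?K" by blast
  qed
  \<comment> \<open>The bijection sends a composition matrix to its poset, and this to the unique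
    fixed matrix with that poset.\<close>
  ultimately show "\<exists>f. bij_betw f ?K ?F" by (blast intro: bij_betw_trans)
  show "\<forall>C \<in> BalMat U // equivalent_on U. \<exists>!A. A \<in> C \<and> eta A = A"
  proof
    fix C assume "C \<in> BalMat U // equivalent_on U"
    then obtain B where B: "B \<in> BalMat U" "C = equivalent_on U `` {B}" by (rule quotientE)
    \<comment> \<open>Equivalence classes are the fibres of \<open>poset_of\<close> on
      \<open>BalMat U\<close>, so existence and injectivity give exactly one fixed matrix in
      each.\<close>
    then have C: "A \<in> C \<longleftrightarrow> A \<in> BalMat U \<and> poset_of A = poset_of B" for A
      by (auto simp: equivalent_on_def)
    obtain A where "A \<in> BalMat U" "eta A = A" "poset_of A = poset_of B"
      using ex_fixed_poset[OF assms B(1)] by blast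
    then show "\<exists>!A. A \<in> C \<and> eta A = A"
      using inj_on_poset_of_fixed[OF assms] unfolding C by (intro ex1I[of _ A]) (auto dest: inj_onD)
  qed
qed

end
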